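(* Let $H(\mathbf{a}) = h_1(\mathbf{x},\mathbf{a}),\ldots,h_K(\mathbf{x},\mathbf{a})$ be a sequence of $K$ complex polynomials in $N$ unknowns $\mathbf{x}=x_1,\ldots,x_N$ and $M$ unknowns $\mathbf{a}=a_1,\ldots,a_M$. Let $\mathbf{x}(\mathbf{b})$ be an isolated multiplicity-one solution to $H(\mathbf{a})$ in $\mathbf{x}$ for $\mathbf{a}:=\mathbf{b}\in\mathbb{C}^M$ (that is, of the system $h_1(\mathbf{x},\mathbf{b})=\cdots=h_K(\mathbf{x},\mathbf{b})=0$). Then $$\left[\frac{\partial x_n(\mathbf{a})}{\partial a_m}(\mathbf{b})\right] = -\left[\frac{\partial h_k(\mathbf{x},\mathbf{a})}{\partial x_n}(\mathbf{x}(\mathbf{b}),\mathbf{b})\right]^{+}\left[\frac{\partial h_k(\mathbf{x},\mathbf{a})}{\partial a_m}(\mathbf{x}(\mathbf{b}),\mathbf{b})\right]$$ with $k=1,\ldots,K$, $m=1,\ldots,M$, $n=1,\ldots,N$, and $[A]^{+}$ denoting the pseudoinverse of the (Jacobian) matrix $[A]$.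
   Context: Notation: $\mathbf{x}(\mathbf{a})=(x_1(\mathbf{a}),\ldots,x_N(\mathbf{a}))$ denotes the solution in $\mathbf{x}$ of the polynomial system $H(\mathbf{a})$, regarded as a function of the parameters $\mathbf{a}$ near $\mathbf{b}$ and taking the value $\mathbf{x}(\mathbf{b})$ at $\mathbf{a}=\mathbf{b}$; it plays the role of the implicitly defined function in the Implicit function theorem. The matrix on the left is $N\times M$ (row index $n$, column index $m$), $\left[\frac{\partial h_k}{\partial x_n}\right]$ is $K\times N$ (row index $k$, column index $n$), and $\left[\frac{\partial h_k}{\partial a_m}\right]$ is $K\times M$ (row index $k$, column index $m$). The pseudoinverse is the Moore–Penrose pseudoinverse. A solution $\mathbf{p}\in\mathbb{C}^N$ of $h_1(\mathbf{x},\mathbf{b})=\cdots=h_K(\mathbf{x},\mathbf{b})=0$ is isolated if some neighbourhood of $\mathbf{p}$ contains no other solution. Its multiplicity is the dimension, as a complex vector space, of the local ring $\mathbb{C}[x_1,\ldots,x_N]_{\mathfrak{m}_{\mathbf{p}}}/\langle h_1(\mathbf{x},\mathbf{b}),\ldots,h_K(\mathbf{x},\mathbf{b})\rangle$, where $\mathfrak{m}_{\mathbf{p}}$ is the maximal ideal of polynomials vanishing at $\mathbf{p}$; multiplicity-one means that this dimension equals $1$. *)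

theory Defs
  imports "HOL-Analysis.Analysis" "HOL-Library.Poly_Mapping"
    "HOL-Algebra.Embedded_Algebras" "HOL-Algebra.QuotRing"
begin

section \<open>Complex polynomials in finitely many unknowns\<close>

text \<open>
  The ring of complex polynomials in unknowns indexed by \<open>'v\<close>: finitely supported maps from
  exponent vectors to coefficients; the ring operations (convolution product) are the type class
  instances of \<^type>\<open>poly_mapping\<close>. A polynomial in the unknowns \<open>x\<close> (indexed by \<open>'n\<close>) and
  \<open>a\<close> (indexed by \<open>'m\<close>) is an \<open>('n + 'm) cpoly\<close>.
\<close>

type_synonym 'v cpoly = "('v \<Rightarrow>\<^sub>0 nat) \<Rightarrow>\<^sub>0 complex"

definition cpoly_const :: "complex \<Rightarrow> 'v cpoly" where
  "cpoly_const c = Poly_Mapping.single 0 c"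

definition cpoly_var :: "'v \<Rightarrow> 'v cpoly" where
  "cpoly_var i = Poly_Mapping.single (Poly_Mapping.single i 1) 1"

text \<open>
  Substitution of elements \<open>s i\<close> of a commutative ring for the unknowns, the coefficients being
  mapped by \<open>c\<close>.
\<close>

definition cpoly_subst ::
    "(complex \<Rightarrow> 'r::comm_ring_1) \<Rightarrow> ('v::finite \<Rightarrow> 'r) \<Rightarrow> 'v cpoly \<Rightarrow> 'r" where
  "cpoly_subst c s f =
     (\<Sum>e\<in>Poly_Mapping.keys f. c (Poly_Mapping.lookup f e) *
        (\<Prod>i\<in>UNIV. s i ^ Poly_Mapping.lookup e i))"

definition cpoly_eval :: "'v::finite cpoly \<Rightarrow> complex ^ 'v \<Rightarrow> complex" where
  "cpoly_eval f p = cpoly_subst (\<lambda>c. c) (\<lambda>i. p $ i) f"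

definition cpoly_eval2 ::
    "('n::finite + 'm::finite) cpoly \<Rightarrow> complex ^ 'n \<Rightarrow> complex ^ 'm \<Rightarrow> complex" where
  "cpoly_eval2 f x a = cpoly_subst (\<lambda>c. c) (case_sum (\<lambda>i. x $ i) (\<lambda>j. a $ j)) f"

text \<open>The polynomial \<open>f(x, b)\<close> in the unknowns \<open>x\<close> alone.\<close>

definition specialize :: "complex ^ 'm \<Rightarrow> ('n::finite + 'm::finite) cpoly \<Rightarrow> 'n cpoly" where
  "specialize b f =
     cpoly_subst cpoly_const (case_sum cpoly_var (\<lambda>j. cpoly_const (b $ j))) f"


section \<open>Localization of a commutative ring\<close>

definition frac_rel :: "'r::comm_ring_1 set \<Rightarrow> (('r \<times> 'r) \<times> ('r \<times> 'r)) set" where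
  "frac_rel S = {((f, g), (f', g')). g \<in> S \<and> g' \<in> S \<and> (\<exists>u\<in>S. u * (f * g' - f' * g) = 0)}"

definition loc_frac :: "'r::comm_ring_1 set \<Rightarrow> 'r \<Rightarrow> 'r \<Rightarrow> ('r \<times> 'r) set" where
  "loc_frac S f g = frac_rel S `` {(f, g)}"

definition localization :: "'r::comm_ring_1 set \<Rightarrow> ('r \<times> 'r) set ring" where
  "localization S =
     \<lparr>carrier = (UNIV \<times> S) // frac_rel S,
      mult = (\<lambda>X Y. \<Union>(f, g)\<in>X. \<Union>(f', g')\<in>Y. loc_frac S (f * f') (g * g')),
      one = loc_frac S 1 1,
      zero = loc_frac S 0 1,
      add = (\<lambda>X Y. \<Union>(f, g)\<in>X. \<Union>(f', g')\<in>Y. loc_frac S (f * g' + f' * g) (g * g'))\<rparr>"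


section \<open>Multiplicity of a solution\<close>

text \<open>The denominators of the local ring at \<open>p\<close>: the complement of the maximal ideal of \<open>p\<close>.\<close>

definition nonvanishing :: "complex ^ 'n::finite \<Rightarrow> 'n cpoly set" where
  "nonvanishing p = {g. cpoly_eval g p \<noteq> 0}"

definition local_ring :: "complex ^ 'n::finite \<Rightarrow> ('n cpoly \<times> 'n cpoly) set ring" where
  "local_ring p = localization (nonvanishing p)"

definition system_ideal ::
    "('k \<Rightarrow> 'n::finite cpoly) \<Rightarrow> complex ^ 'n \<Rightarrow> ('n cpoly \<times> 'n cpoly) set set" where
  "system_ideal F p = genideal (local_ring p) (range (\<lambda>k. loc_frac (nonvanishing p) (F k) 1))"

definition multiplicity_ring ::
    "('k \<Rightarrow> 'n::finite cpoly) \<Rightarrow> complex ^ 'n \<Rightarrow> ('n cpoly \<times> 'n cpoly) set set ring" where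
  "multiplicity_ring F p = local_ring p Quot system_ideal F p"

text \<open>The image of the complex numbers in \<open>multiplicity_ring F p\<close>.\<close>

definition multiplicity_scalars ::
    "('k \<Rightarrow> 'n::finite cpoly) \<Rightarrow> complex ^ 'n \<Rightarrow> ('n cpoly \<times> 'n cpoly) set set set" where
  "multiplicity_scalars F p =
     range (\<lambda>c. a_r_coset (local_ring p) (system_ideal F p)
                  (loc_frac (nonvanishing p) (cpoly_const c) 1))"

text \<open>
  A relation instead of a number-valued function, as the dimension need not be finite. The
  relation \<^const>\<open>ring.dimension\<close> takes the scalars as a subset of the ring; the vector space
  operations of \<open>multiplicity_ring F p\<close> over the complex numbers are those over their image.
\<close>

definition has_multiplicity ::
    "('k \<Rightarrow> 'n::finite cpoly) \<Rightarrow> complex ^ 'n \<Rightarrow> nat \<Rightarrow> bool" where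
  "has_multiplicity F p d \<longleftrightarrow>
     ring.dimension (multiplicity_ring F p) d (multiplicity_scalars F p)
       (carrier (multiplicity_ring F p))"

definition solutions :: "('k \<Rightarrow> 'n::finite cpoly) \<Rightarrow> (complex ^ 'n) set" where
  "solutions F = {q. \<forall>k. cpoly_eval (F k) q = 0}"


section \<open>Complex partial derivatives\<close>

definition vec_upd :: "'a ^ 'n \<Rightarrow> 'n::finite \<Rightarrow> 'a \<Rightarrow> 'a ^ 'n" where
  "vec_upd v j t = (\<chi> i. if i = j then t else v $ i)"

definition partially_differentiable ::
    "(complex ^ 'n::finite \<Rightarrow> complex ^ 'm::finite) \<Rightarrow> complex ^ 'n \<Rightarrow> bool" where
  "partially_differentiable f c \<longleftrightarrow>
     (\<forall>i j. (\<lambda>t. f (vec_upd c j t) $ i) field_differentiable at (c $ j))"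

definition jacobian_matrix ::
    "(complex ^ 'n::finite \<Rightarrow> complex ^ 'm::finite) \<Rightarrow> complex ^ 'n \<Rightarrow> complex ^ 'n ^ 'm" where
  "jacobian_matrix f c = (\<chi> i j. deriv (\<lambda>t. f (vec_upd c j t) $ i) (c $ j))"


section \<open>Moore--Penrose pseudoinverse\<close>

definition conj_transpose :: "complex ^ 'n ^ 'm \<Rightarrow> complex ^ 'm ^ 'n" where
  "conj_transpose A = (\<chi> i j. cnj (A $ j $ i))"

text \<open>The four Penrose conditions, which determine \<open>X\<close> uniquely.\<close>

definition is_pinv ::
    "complex ^ 'n::finite ^ 'm::finite \<Rightarrow> complex ^ 'm ^ 'n \<Rightarrow> bool" where
  "is_pinv A X \<longleftrightarrow>
     A ** X ** A = A \<and> X ** A ** X = X \<and>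
     conj_transpose (A ** X) = A ** X \<and> conj_transpose (X ** A) = X ** A"

definition pinv :: "complex ^ 'n::finite ^ 'm::finite \<Rightarrow> complex ^ 'm ^ 'n" where
  "pinv A = (THE X. is_pinv A X)"

end

theory Submission
  imports Defs
begin

text \<open>
  Write \<open>A\<close> and \<open>B\<close> for the Jacobian matrices of the system in \<open>x\<close> and in \<open>a\<close> at \<open>(x(b), b)\<close>.
  Multiplicity one forces \<open>A\<close> to have trivial kernel: for \<open>u\<close> in the kernel,
  \<open>f \<mapsto> f(x(b)) + \<epsilon> D\<^sub>u f(x(b))\<close> is a homomorphism from the local ring to the dual numbers that
  kills the system, so its image has dimension at most one, whereas for \<open>u \<noteq> 0\<close> the images of \<open>1\<close>
  and of some \<open>x\<^sub>i - x\<^sub>i(b)\<close> are linearly independent. Hence \<open>A\<^sup>+ A = 1\<close>. Applying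
  \<open>A\<^sup>+\<close> to the first-order expansion of \<open>h(x(a), a) = 0\<close> gives
  \<open>x(a) - x(b) = - A\<^sup>+ B (a - b) + o(|x(a) - x(b)| + |a - b|)\<close>; this first shows that \<open>x\<close> is
  Lipschitz at \<open>b\<close>, and then that the error is \<open>o(|a - b|)\<close>.
\<close>


section \<open>Pseudoinverse of an injective matrix\<close>

lemma conj_transpose_mult:
  fixes A :: "complex ^ 'n::finite ^ 'm::finite" and B :: "complex ^ 'l::finite ^ 'n"
  shows "conj_transpose (A ** B) = conj_transpose B ** conj_transpose A"
  by (simp add: conj_transpose_def matrix_matrix_mult_def vec_eq_iff mult.commute)

lemma conj_transpose_conj_transpose [simp]: "conj_transpose (conj_transpose A) = A"
  by (simp add: conj_transpose_def vec_eq_iff)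

lemma conj_transpose_mat_1 [simp]: "conj_transpose (mat 1) = mat 1"
  by (simp add: conj_transpose_def vec_eq_iff mat_def)

text \<open>Taking adjoints in \<open>A ** Y ** (A ** X) = A ** X\<close> reverses the two
  self-adjoint factors on the left, which gives \<open>A ** X = A ** Y\<close>; likewise
  \<open>X ** A = Y ** A\<close>. With both products equal, \<open>X ** A ** X = X\<close> turns
  \<open>X\<close> into \<open>Y\<close>.\<close>

lemma is_pinv_unique:
  assumes X: "is_pinv A X" and Y: "is_pinv A Y"
  shows "X = Y"
proof -
  have "A ** Y ** (A ** X) = A ** X" "A ** X ** (A ** Y) = A ** Y"
    using X Y unfolding is_pinv_def by (simp_all add: matrix_mul_assoc)
  moreover have "X ** A ** (Y ** A) = X ** A" "Y ** A ** (X ** A) = Y ** A"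
    using X Y unfolding is_pinv_def by (simp_all flip: matrix_mul_assoc)
  ultimately have AX: "A ** X = A ** Y" and XA: "X ** A = Y ** A"
    using X Y conj_transpose_mult[of "A ** Y" "A ** X"] conj_transpose_mult[of "X ** A" "Y ** A"]
    unfolding is_pinv_def by simp_all
  have "X = X ** A ** X"
    using X by (simp add: is_pinv_def)
  also have "\<dots> = Y ** (A ** X)"
    by (simp add: XA matrix_mul_assoc)
  also have "\<dots> = Y"
    using Y by (simp add: AX is_pinv_def matrix_mul_assoc)
  finally show ?thesis .
qed

text \<open>Pairing the hypothesis with \<open>u\<close> yields the squared norm of
  \<open>A *v u\<close>.\<close>

lemma conj_transpose_mult_self_eq_0:
  fixes A :: "complex ^ 'n::finite ^ 'm::finite"
  assumes "(conj_transpose A ** A) *v u = 0"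
  shows "A *v u = 0"
proof -
  let ?w = "A *v u"
  have "(\<Sum>i\<in>UNIV. cnj (u $ i) * (conj_transpose A *v w) $ i) = (\<Sum>k\<in>UNIV. cnj (?w $ k) * w $ k)" for w
    unfolding conj_transpose_def matrix_vector_mult_def
    by (simp add: sum_distrib_left sum_distrib_right mult_ac) (rule sum.swap)
  from this[of ?w] have "(\<Sum>k\<in>UNIV. cnj (?w $ k) * ?w $ k) = 0"
    using assms by (simp add: matrix_vector_mul_assoc)
  then have "complex_of_real (\<Sum>k\<in>UNIV. (norm (?w $ k))\<^sup>2) = 0"
    by (simp only: complex_norm_square of_real_sum mult.commute)
  then have "(\<Sum>k\<in>UNIV. (norm (?w $ k))\<^sup>2) = 0"
    using of_real_eq_0_iff by blast
  then show ?thesis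
    by (simp add: sum_nonneg_eq_0_iff vec_eq_iff)
qed

text \<open>Injectivity makes the Gram matrix \<open>conj_transpose A ** A\<close> invertible. The
  least-squares inverse built from it is a left inverse of \<open>A\<close> and meets the Penrose
  conditions, so by uniqueness it is \<open>pinv A\<close>.\<close>

lemma pinv_mult_injective:
  fixes A :: "complex ^ 'n::finite ^ 'm::finite"
  assumes inj: "\<And>u. A *v u = 0 \<Longrightarrow> u = 0"
  shows "pinv A ** A = mat 1"
proof -
  define G where "G = conj_transpose A ** A"
  obtain C where CG: "C ** G = mat 1"
    using matrix_left_invertible_ker[of G] conj_transpose_mult_self_eq_0[of A] inj
    unfolding G_def by blast
  then have GC: "G ** C = mat 1"
    by (simp add: matrix_left_right_inverse)
  have "conj_transpose G = G"
    by (simp add: G_def conj_transpose_mult)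
  \<comment> \<open>The adjoint of \<open>C\<close> is a second left inverse of \<open>G\<close>,
    hence equal to \<open>C\<close>. This makes \<open>A ** C ** conj_transpose A\<close>
    self-adjoint.\<close>
  then have "conj_transpose C ** G = mat 1"
    by (metis GC conj_transpose_mult conj_transpose_mat_1)
  then have "conj_transpose C ** G ** C = C"
    by simp
  then have C: "conj_transpose C = C"
    using GC by (simp flip: matrix_mul_assoc)
  let ?X = "C ** conj_transpose A"
  have XA: "?X ** A = mat 1"
    using CG by (simp add: G_def matrix_mul_assoc)
  have "is_pinv A ?X"
    unfolding is_pinv_def using XA
    by (simp add: C conj_transpose_mult matrix_mul_assoc[symmetric])
  then have "pinv A = ?X"
    unfolding pinv_def by (intro the_equality is_pinv_unique)
  then show ?thesis
    using XA by simp
qed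


section \<open>Derivative of an implicit function\<close>

text \<open>The solution \<open>x\<close> is given and continuous at \<open>b\<close>, so only its
  differentiability is at stake. A left inverse \<open>L\<close> of the derivative in the first
  variable is enough for that, which allows more equations than unknowns.\<close>

lemma implicit_function_has_derivative:
  fixes f :: "'a::real_normed_vector \<times> 'b::real_normed_vector \<Rightarrow> 'c::real_normed_vector"
    and x :: "'b \<Rightarrow> 'a"
  assumes deriv: "(f has_derivative (\<lambda>(d, e). A d + B e)) (at (x b, b))"
    and B: "bounded_linear B"
    and L: "bounded_linear L" and LA: "\<And>d. L (A d) = d"
    and zero: "\<forall>\<^sub>F a in nhds b. f (x a, a) = 0"
    and cont: "isCont x b"
  shows "(x has_derivative (\<lambda>e. - L (B e))) (at b)"
proof -
  let ?M = "\<lambda>e. L (B e)"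
  have M: "bounded_linear ?M"
    using bounded_linear_compose[OF L B] .
  obtain K where K: "K > 0" "\<And>v. norm (L v) \<le> norm v * K"
    using bounded_linear.pos_bounded[OF L] by blast
  obtain C where C: "C > 0" "\<And>v. norm (?M v) \<le> norm v * C"
    using bounded_linear.pos_bounded[OF M] by blast
  have zero_b: "f (x b, b) = 0"
    using zero by (rule eventually_nhds_x_imp_x)
  have cont_pair: "((\<lambda>a. (x a, a)) \<longlongrightarrow> (x b, b)) (nhds b)"
    using cont by (intro tendsto_Pair) (simp_all add: continuous_at filterlim_ident tendsto_at_iff_tendsto_nhds)
  \<comment> \<open>Linearizing \<open>f (x a, a) = 0\<close> with tolerance \<open>e / K\<close>
    compensates for the factor \<open>K\<close> by which \<open>L\<close> may enlarge the
    error.\<close>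
  have close: "\<forall>\<^sub>F a in nhds b. norm (x a - x b + ?M (a - b)) \<le> e * (norm (x a - x b) + norm (a - b))"
    if "e > 0" for e
  proof -
    have "e / K > 0"
      using that K by simp
    then obtain r where r: "r > 0"
      "\<And>z. norm (z - (x b, b)) < r \<Longrightarrow>
        norm (f z - f (x b, b) - (case z - (x b, b) of (d, e) \<Rightarrow> A d + B e)) \<le> e / K * norm (z - (x b, b))"
      using deriv unfolding has_derivative_at_alt by blast
    have "\<forall>\<^sub>F a in nhds b. dist (x a, a) (x b, b) < r"
      using cont_pair r(1) by (rule tendstoD)
    with zero show ?thesis
    proof eventually_elim
      case (elim a)
      let ?d = "x a - x b" and ?e = "a - b"
      have "norm (A ?d + B ?e) = norm (0 - 0 - (A ?d + B ?e))"
        by (metis diff_0 diff_0_right norm_minus_cancel)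
      also have "\<dots> \<le> e / K * norm (?d, ?e)"
        using r(2)[of "(x a, a)"] elim zero_b by (simp add: dist_norm)
      also have "\<dots> \<le> e / K * (norm ?d + norm ?e)"
        using \<open>e / K > 0\<close> by (intro mult_left_mono norm_Pair_le) auto
      finally have *: "norm (A ?d + B ?e) \<le> e / K * (norm ?d + norm ?e)" .
      have "?d + ?M ?e = L (A ?d + B ?e)"
        using LA by (simp add: linear_add[OF bounded_linear.linear[OF L]])
      then have "norm (?d + ?M ?e) \<le> norm (A ?d + B ?e) * K"
        using K(2) by simp
      also have "\<dots> \<le> e / K * (norm ?d + norm ?e) * K"
        using * K(1) by (intro mult_right_mono) auto
      finally show ?case
        using K(1) by simp
    qed
  qed
  \<comment> \<open>With tolerance 1/2, half of \<open>norm (x a - x b)\<close> is absorbed on the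
    left; doubling what remains gives the constant \<open>2 * C + 1\<close>.\<close>
  have half: "(1 / 2 :: real) > 0"
    by simp
  have lipschitz: "\<forall>\<^sub>F a in nhds b. norm (x a - x b) \<le> (2 * C + 1) * norm (a - b)"
    using close[OF half]
  proof eventually_elim
    case (elim a)
    have "norm (x a - x b) \<le> norm (x a - x b + ?M (a - b)) + norm (?M (a - b))"
      using norm_triangle_ineq4[of "x a - x b + ?M (a - b)" "?M (a - b)"] by simp
    then show ?case
      using elim C(2)[of "a - b"] by (simp add: algebra_simps)
  qed
  show ?thesis
    unfolding has_derivative_at_alt
  proof (intro conjI allI impI)
    show "bounded_linear (\<lambda>e. - ?M e)"
      using M by (rule bounded_linear_minus)
    fix e :: real assume "e > 0"
    \<comment> \<open>By the Lipschitz bound, the two norms on the right of \<open>close\<close> add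
      up to at most \<open>(2 * C + 2) * norm (a - b)\<close>.\<close>
    define e' where "e' = e / (2 * C + 2)"
    have e': "e' > 0" "e' * (2 * C + 2) = e"
      using \<open>e > 0\<close> C(1) by (auto simp: e'_def)
    have "\<forall>\<^sub>F a in nhds b. norm (x a - x b - - ?M (a - b)) \<le> e * norm (a - b)"
      using close[OF e'(1)] lipschitz
    proof eventually_elim
      case (elim a)
      have "e' * (norm (x a - x b) + norm (a - b)) \<le> e' * ((2 * C + 2) * norm (a - b))"
        using elim(2) e'(1) by (intro mult_left_mono) (auto simp: algebra_simps)
      with elim(1) e'(2) show ?case
        by (simp add: mult.assoc[symmetric])
    qed
    then show "\<exists>d>0. \<forall>a. norm (a - b) < d \<longrightarrow> norm (x a - x b - - ?M (a - b)) \<le> e * norm (a - b)"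
      unfolding eventually_nhds_metric dist_norm .
  qed
qed

section \<open>Complex partial derivatives from a total derivative\<close>

lemma bounded_linear_axis: "bounded_linear (axis j :: complex \<Rightarrow> complex ^ 'n::finite)"
  by (intro linear_conv_bounded_linear[THEN iffD1] linearI) (auto simp: axis_def vec_eq_iff)

lemma vec_upd_has_derivative:
  "((\<lambda>t. vec_upd c j t) has_derivative (\<lambda>s. axis j (s::complex))) (at t0)"
proof -
  have "vec_upd c j t = (c - axis j (c $ j)) + axis j t" for t
    by (simp add: vec_upd_def axis_def vec_eq_iff)
  moreover have "((\<lambda>t. (c - axis j (c $ j)) + axis j t) has_derivative (\<lambda>s. 0 + axis j s)) (at t0)"
    by (intro has_derivative_add has_derivative_const bounded_linear_imp_has_derivative
        bounded_linear_axis)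
  ultimately show ?thesis
    by simp
qed

lemma has_derivative_vec_lambda:
  fixes f :: "'k::finite \<Rightarrow> 'a::real_normed_vector \<Rightarrow> complex"
  assumes "\<And>k. (f k has_derivative f' k) F"
  shows "((\<lambda>z. \<chi> k. f k z) has_derivative (\<lambda>z. \<chi> k. f' k z)) F"
proof -
  have *: "(\<chi> k. g k) = (\<Sum>k\<in>UNIV. axis k (g k))" for g :: "'k \<Rightarrow> complex"
    by (simp add: vec_eq_iff axis_def if_distrib cong: if_cong)
  show ?thesis
    unfolding * using assms
    by (intro has_derivative_sum bounded_linear.has_derivative[OF bounded_linear_axis])
qed

text \<open>\<open>has_derivative\<close> is a real notion. Since the derivative is multiplication
  by a complex matrix, its restriction to a coordinate line is multiplication by an entry of
  \<open>M\<close>, that is, a complex derivative.\<close>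

lemma has_derivative_matrix_imp_jacobian:
  fixes f :: "complex ^ 'n::finite \<Rightarrow> complex ^ 'm::finite"
  assumes "(f has_derivative ((*v) M)) (at c)"
  shows "partially_differentiable f c" "jacobian_matrix f c = M"
proof -
  have *: "((\<lambda>t. f (vec_upd c j t) $ i) has_field_derivative M $ i $ j) (at (c $ j))" for i j
  proof -
    have c: "vec_upd c j (c $ j) = c"
      by (simp add: vec_upd_def vec_eq_iff)
    have "((\<lambda>t. f (vec_upd c j t) $ i) has_derivative (\<lambda>s. (M *v axis j s) $ i)) (at (c $ j))"
      using assms
      by (intro bounded_linear.has_derivative[OF bounded_linear_vec_nth]
          has_derivative_compose[OF vec_upd_has_derivative]) (simp add: c)
    moreover have "(M *v axis j s) $ i = M $ i $ j * s" for s
      by (simp add: matrix_vector_mult_def axis_def if_distrib cong: if_cong)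
    ultimately show ?thesis
      by (simp add: has_field_derivative_def)
  qed
  show "partially_differentiable f c"
    unfolding partially_differentiable_def field_differentiable_def using * by blast
  show "jacobian_matrix f c = M"
    by (simp add: jacobian_matrix_def vec_eq_iff DERIV_imp_deriv[OF *])
qed


section \<open>Evaluation of polynomials\<close>

text \<open>Updating a key outside the support amounts to adding a monomial. The additive form of
  the induction fits maps that respect sums, such as substitution.\<close>

lemma poly_mapping_induct_add_single [case_names zero add]:
  fixes f :: "'a \<Rightarrow>\<^sub>0 'b::monoid_add"
  assumes "P 0" and "\<And>f e a. P f \<Longrightarrow> P (f + Poly_Mapping.single e a)"
  shows "P f"
proof (induction f rule: Poly_Mapping.update_induct)
  case const
  show ?case by (rule assms(1))
next
  case (update f e a)
  have "Poly_Mapping.update e a f = f + Poly_Mapping.single e a"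
    using update(1)
    by (auto intro!: poly_mapping_eqI simp: Poly_Mapping.lookup_update lookup_add lookup_single in_keys_iff when_def)
  then show ?case
    using assms(2) update by simp
qed

lemma cpoly_subst_0 [simp]: "cpoly_subst c s 0 = 0"
  by (simp add: cpoly_subst_def)

lemma cpoly_subst_single:
  assumes "c 0 = 0"
  shows "cpoly_subst c s (Poly_Mapping.single e a) =
    c a * (\<Prod>i\<in>UNIV. s i ^ Poly_Mapping.lookup e i)"
  by (simp add: cpoly_subst_def assms)

text \<open>The support of \<open>f + g\<close> can be smaller than the union of the supports;
  cancelled coefficients contribute nothing because \<open>c 0 = 0\<close>.\<close>

lemma cpoly_subst_add:
  assumes "c 0 = 0" and "\<And>a b. c (a + b) = c a + c b"
  shows "cpoly_subst c s (f + g) = cpoly_subst c s f + cpoly_subst c s g"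
  unfolding cpoly_subst_def
  using setsum_keys_plus_distrib
    [of "\<lambda>e a. c a * (\<Prod>i\<in>UNIV. s i ^ Poly_Mapping.lookup e i)" f g]
  by (simp add: assms distrib_right)

text \<open>Both sides are additive in each factor, so induction on \<open>f\<close> and on
  \<open>g\<close> reduces the claim to two monomials, where exponents add.\<close>

lemma cpoly_subst_mult:
  assumes c: "c 0 = 0" "\<And>a b. c (a + b) = c a + c b" "\<And>a b. c (a * b) = c a * c b"
  shows "cpoly_subst c s (f * g) = cpoly_subst c s f * cpoly_subst c s g"
proof -
  have single: "cpoly_subst c s (f * Poly_Mapping.single e b) =
      cpoly_subst c s f * cpoly_subst c s (Poly_Mapping.single e b)" for f e b
  proof (induction f rule: poly_mapping_induct_add_single)
    case (add f e' a)
    have "cpoly_subst c s (Poly_Mapping.single e' a * Poly_Mapping.single e b) =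
        cpoly_subst c s (Poly_Mapping.single e' a) * cpoly_subst c s (Poly_Mapping.single e b)"
      by (simp add: mult_single cpoly_subst_single c lookup_add power_add prod.distrib mult_ac)
    with add show ?case
      by (simp add: distrib_right cpoly_subst_add c)
  qed simp
  show ?thesis
    by (induction g rule: poly_mapping_induct_add_single)
      (simp_all add: distrib_left cpoly_subst_add c single)
qed

lemma cpoly_eval_0 [simp]: "cpoly_eval 0 p = 0"
  by (simp add: cpoly_eval_def)

lemma cpoly_eval_const [simp]: "cpoly_eval (cpoly_const a) p = a"
  by (simp add: cpoly_eval_def cpoly_const_def cpoly_subst_single)

lemma cpoly_const_1: "cpoly_const 1 = 1"
  by (simp add: cpoly_const_def)

lemma cpoly_eval_1 [simp]: "cpoly_eval 1 p = 1"
  by (simp flip: cpoly_const_1)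

lemma cpoly_eval_var [simp]: "cpoly_eval (cpoly_var i) p = p $ i"
  by (simp add: cpoly_eval_def cpoly_var_def cpoly_subst_single lookup_single when_def
      if_distrib prod.delta cong: if_cong)

lemma cpoly_eval_add [simp]: "cpoly_eval (f + g) p = cpoly_eval f p + cpoly_eval g p"
  by (simp add: cpoly_eval_def cpoly_subst_add)

lemma cpoly_eval_diff [simp]: "cpoly_eval (f - g) p = cpoly_eval f p - cpoly_eval g p"
  using cpoly_eval_add[of "f - g" g p] by (simp add: algebra_simps)

lemma cpoly_eval_mult [simp]: "cpoly_eval (f * g) p = cpoly_eval f p * cpoly_eval g p"
  by (simp add: cpoly_eval_def cpoly_subst_mult)

lemma cpoly_eval_power [simp]: "cpoly_eval (f ^ n) p = cpoly_eval f p ^ n"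
  by (induction n) simp_all

lemma cpoly_eval_sum [simp]: "cpoly_eval (sum f I) p = (\<Sum>i\<in>I. cpoly_eval (f i) p)"
  by (induction I rule: infinite_finite_induct) simp_all

lemma cpoly_eval_prod [simp]: "cpoly_eval (prod f I) p = (\<Prod>i\<in>I. cpoly_eval (f i) p)"
  by (induction I rule: infinite_finite_induct) simp_all

lemma cpoly_eval_specialize: "cpoly_eval (specialize b f) y = cpoly_eval2 f y b"
proof -
  \<comment> \<open>Evaluation respects sums and products, so only the values substituted for the
    unknowns have to be compared.\<close>
  have "cpoly_eval (case_sum cpoly_var (\<lambda>j. cpoly_const (b $ j)) i) y =
      case_sum (($) y) (($) b) i" for i
    by (cases i) simp_all
  then show ?thesis
    by (simp add: specialize_def cpoly_eval2_def cpoly_subst_def)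
qed

section \<open>Total derivatives of polynomial maps\<close>

lemma cpoly_eval_has_derivative:
  obtains c where "(cpoly_eval f has_derivative (\<lambda>d. \<Sum>i\<in>UNIV. c i * d $ i)) (at p)"
proof
  let ?n = "Poly_Mapping.lookup"
  \<comment> \<open>\<open>?c i\<close> is the \<open>i\<close>-th partial derivative of
    \<open>f\<close> at \<open>p\<close>. At exponent 0 the truncated \<open>?n e i - 1\<close> is
    harmless, as the factor \<open>of_nat (?n e i)\<close> vanishes.\<close>
  let ?c = "\<lambda>i. \<Sum>e\<in>Poly_Mapping.keys f. ?n f e *
    (of_nat (?n e i) * p $ i ^ (?n e i - 1) * (\<Prod>j\<in>UNIV - {i}. p $ j ^ ?n e j))"
  have "(cpoly_eval f has_derivative (\<lambda>d. \<Sum>e\<in>Poly_Mapping.keys f. ?n f e *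
     (\<Sum>i\<in>UNIV. of_nat (?n e i) * d $ i * p $ i ^ (?n e i - 1) *
       (\<Prod>j\<in>UNIV - {i}. p $ j ^ ?n e j)))) (at p)"
    unfolding cpoly_eval_def[abs_def] cpoly_subst_def
    by (intro has_derivative_sum has_derivative_mult_right has_derivative_prod has_derivative_power
        bounded_linear_imp_has_derivative bounded_linear_vec_nth)
  moreover have "(\<Sum>e\<in>Poly_Mapping.keys f. ?n f e *
     (\<Sum>i\<in>UNIV. of_nat (?n e i) * d $ i * p $ i ^ (?n e i - 1) *
       (\<Prod>j\<in>UNIV - {i}. p $ j ^ ?n e j))) = (\<Sum>i\<in>UNIV. ?c i * d $ i)" for d
    unfolding sum_distrib_left sum_distrib_right
    by (subst sum.swap) (simp add: mult_ac)
  ultimately show "(cpoly_eval f has_derivative (\<lambda>d. \<Sum>i\<in>UNIV. ?c i * d $ i)) (at p)"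
    by simp
qed

lemma cpoly_eval2_has_derivative:
  fixes f :: "('n::finite + 'm::finite) cpoly"
  obtains \<alpha> \<beta> where "((\<lambda>(y, a). cpoly_eval2 f y a) has_derivative
    (\<lambda>(d, e). (\<Sum>i\<in>UNIV. \<alpha> i * d $ i) + (\<Sum>j\<in>UNIV. \<beta> j * e $ j))) (at (y0, a0))"
proof -
  \<comment> \<open>\<open>J\<close> merges the two groups of unknowns into one point, so the chain
    rule reduces the claim to a single group.\<close>
  define J :: "(complex ^ 'n) \<times> (complex ^ 'm) \<Rightarrow> complex ^ ('n + 'm)"
    where "J = (\<lambda>(y, a). \<chi> s. case_sum (($) y) (($) a) s)"
  have "linear J"
    by (intro linearI) (auto simp: J_def vec_eq_iff split: sum.split)
  then have J: "bounded_linear J"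
    by (simp add: linear_conv_bounded_linear)
  obtain c where c: "(cpoly_eval f has_derivative (\<lambda>d. \<Sum>i\<in>UNIV. c i * d $ i)) (at (J (y0, a0)))"
    by (rule cpoly_eval_has_derivative)
  have "((\<lambda>z. cpoly_eval f (J z)) has_derivative (\<lambda>z. \<Sum>i\<in>UNIV. c i * J z $ i)) (at (y0, a0))"
    using bounded_linear_imp_has_derivative[OF J] c by (rule has_derivative_compose)
  moreover have "(\<lambda>z. cpoly_eval f (J z)) = (\<lambda>(y, a). cpoly_eval2 f y a)"
    by (simp add: J_def cpoly_eval_def cpoly_eval2_def split_def vec_lambda_inverse)
  moreover have "sum g UNIV = (\<Sum>i\<in>UNIV. g (Inl i)) + (\<Sum>j\<in>UNIV. g (Inr j))"
    for g :: "'n + 'm \<Rightarrow> complex"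
    using sum.Plus[of "UNIV :: 'n set" "UNIV :: 'm set"] by simp
  then have "(\<lambda>z. \<Sum>i\<in>UNIV. c i * J z $ i) =
      (\<lambda>(d, e). (\<Sum>i\<in>UNIV. c (Inl i) * d $ i) + (\<Sum>j\<in>UNIV. c (Inr j) * e $ j))"
    by (simp add: J_def split_def)
  ultimately show ?thesis
    using that by simp
qed

lemma cpoly_eval2_system_has_derivative:
  fixes h :: "'k::finite \<Rightarrow> ('n::finite + 'm::finite) cpoly"
  obtains A B where "((\<lambda>(y, a). \<chi> k. cpoly_eval2 (h k) y a) has_derivative
    (\<lambda>(d, e). A *v d + B *v e)) (at (y0, a0))"
proof -
  have "\<forall>k. \<exists>\<alpha> \<beta>. ((\<lambda>(y, a). cpoly_eval2 (h k) y a) has_derivative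
    (\<lambda>(d, e). (\<Sum>i\<in>UNIV. \<alpha> i * d $ i) + (\<Sum>j\<in>UNIV. \<beta> j * e $ j))) (at (y0, a0))"
    by (intro allI, rule cpoly_eval2_has_derivative) blast
  then obtain \<alpha> \<beta> where "\<And>k. ((\<lambda>(y, a). cpoly_eval2 (h k) y a) has_derivative
    (\<lambda>(d, e). (\<Sum>i\<in>UNIV. \<alpha> k i * d $ i) + (\<Sum>j\<in>UNIV. \<beta> k j * e $ j))) (at (y0, a0))"
    unfolding choice_iff by blast
  then have "((\<lambda>z. \<chi> k. case z of (y, a) \<Rightarrow> cpoly_eval2 (h k) y a) has_derivative
    (\<lambda>z. \<chi> k. case z of (d, e) \<Rightarrow>
      (\<Sum>i\<in>UNIV. \<alpha> k i * d $ i) + (\<Sum>j\<in>UNIV. \<beta> k j * e $ j))) (at (y0, a0))"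
    by (intro has_derivative_vec_lambda) blast
  moreover have "(\<lambda>z. \<chi> k. case z of (y, a) \<Rightarrow> cpoly_eval2 (h k) y a) =
      (\<lambda>(y, a). \<chi> k. cpoly_eval2 (h k) y a)"
    by (simp add: split_def)
  moreover have "(\<lambda>z. \<chi> k. case z of (d, e) \<Rightarrow>
        (\<Sum>i\<in>UNIV. \<alpha> k i * d $ i) + (\<Sum>j\<in>UNIV. \<beta> k j * e $ j)) =
      (\<lambda>(d, e). (\<chi> k i. \<alpha> k i) *v d + (\<chi> k j. \<beta> k j) *v e)"
    by (simp add: matrix_vector_mult_def vec_eq_iff split_def fun_eq_iff)
  ultimately show ?thesis
    using that by simp
qed

text \<open>The analytic form lets the sum and product rules come from calculus. Together with the
  value at \<open>p\<close>, this is the first-order part of \<open>f\<close> along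
  \<open>u\<close>: the coefficient of the dual unit.\<close>

definition dir_deriv :: "complex ^ 'n::finite \<Rightarrow> complex ^ 'n \<Rightarrow> 'n cpoly \<Rightarrow> complex" where
  "dir_deriv p u f = deriv (\<lambda>t. cpoly_eval f (p + t *s u)) 0"

lemma has_derivative_line:
  "((\<lambda>t. p + t *s (u :: complex ^ 'n::finite)) has_derivative (\<lambda>t. t *s u)) F"
proof -
  have "bounded_linear (\<lambda>t. t *s u)"
    by (intro linear_conv_bounded_linear[THEN iffD1] linearI) (auto simp: vec_eq_iff algebra_simps)
  from has_derivative_add[OF has_derivative_const bounded_linear_imp_has_derivative[OF this]]
  show ?thesis by simp
qed

lemma cpoly_eval_line_has_field_derivative:
  "((\<lambda>t. cpoly_eval f (p + t *s u)) has_field_derivative dir_deriv p u f) (at 0)"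
proof -
  obtain c where "(cpoly_eval f has_derivative (\<lambda>d. \<Sum>i\<in>UNIV. c i * d $ i)) (at p)"
    by (rule cpoly_eval_has_derivative)
  then have "((\<lambda>t. cpoly_eval f (p + t *s u)) has_derivative
      (\<lambda>t. \<Sum>i\<in>UNIV. c i * (t *s u) $ i)) (at 0)"
    by (intro has_derivative_compose[OF has_derivative_line]) simp
  also have "(\<lambda>t. \<Sum>i\<in>UNIV. c i * (t *s u) $ i) = (*) (\<Sum>i\<in>UNIV. c i * u $ i)"
    by (simp add: fun_eq_iff sum_distrib_left sum_distrib_right mult_ac)
  finally have "((\<lambda>t. cpoly_eval f (p + t *s u)) has_field_derivative (\<Sum>i\<in>UNIV. c i * u $ i)) (at 0)"
    by (simp add: has_field_derivative_def)
  then show ?thesis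
    unfolding dir_deriv_def by (simp add: DERIV_imp_deriv)
qed

lemma dir_deriv_eqI:
  "((\<lambda>t. cpoly_eval f (p + t *s u)) has_field_derivative D) (at 0) \<Longrightarrow> dir_deriv p u f = D"
  unfolding dir_deriv_def by (rule DERIV_imp_deriv)

lemma dir_deriv_const [simp]: "dir_deriv p u (cpoly_const a) = 0"
  by (rule dir_deriv_eqI) simp

lemma dir_deriv_0 [simp]: "dir_deriv p u 0 = 0"
  by (rule dir_deriv_eqI) simp

lemma dir_deriv_1 [simp]: "dir_deriv p u 1 = 0"
  by (rule dir_deriv_eqI) simp

lemma dir_deriv_var [simp]: "dir_deriv p u (cpoly_var i) = u $ i"
  by (rule dir_deriv_eqI) (auto intro!: derivative_eq_intros)

lemma dir_deriv_add [simp]: "dir_deriv p u (f + g) = dir_deriv p u f + dir_deriv p u g"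
  by (rule dir_deriv_eqI)
    (auto intro!: derivative_eq_intros cpoly_eval_line_has_field_derivative)

lemma dir_deriv_diff [simp]: "dir_deriv p u (f - g) = dir_deriv p u f - dir_deriv p u g"
  by (rule dir_deriv_eqI)
    (auto intro!: derivative_eq_intros cpoly_eval_line_has_field_derivative)

lemma dir_deriv_mult [simp]:
  "dir_deriv p u (f * g) = dir_deriv p u f * cpoly_eval g p + cpoly_eval f p * dir_deriv p u g"
  by (rule dir_deriv_eqI)
    (auto intro!: derivative_eq_intros cpoly_eval_line_has_field_derivative)

text \<open>The link between analysis and algebra, by the chain rule along a line: kernel vectors of
  the Jacobian matrix are directions in which every equation vanishes to first order.\<close>

lemma dir_deriv_eq_matrix_mult:
  assumes "((\<lambda>y. \<chi> k. cpoly_eval (F k) y) has_derivative ((*v) A)) (at p)"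
  shows "dir_deriv p u (F k) = (A *v u) $ k"
proof (rule dir_deriv_eqI)
  have "((\<lambda>t. (\<chi> k. cpoly_eval (F k) (p + t *s u)) $ k) has_derivative
      (\<lambda>t. (A *v (t *s u)) $ k)) (at 0)"
    using assms
    by (intro bounded_linear.has_derivative[OF bounded_linear_vec_nth]
        has_derivative_compose[OF has_derivative_line]) simp
  then show "((\<lambda>t. cpoly_eval (F k) (p + t *s u)) has_field_derivative (A *v u) $ k) (at 0)"
    by (simp add: has_field_derivative_def vector_scalar_commute mult_commute_abs)
qed


section \<open>Localization\<close>

text \<open>Reduces the operations of \<open>localization\<close>, which are unions over
  representatives, to independence of the representatives; the two memberships make the union
  nonempty.\<close>

lemma UN_pair_eqI:
  assumes "(f, g) \<in> X" "(f', g') \<in> Y"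
    and "\<And>a c a' c'. (a, c) \<in> X \<Longrightarrow> (a', c') \<in> Y \<Longrightarrow> F a c a' c' = Z"
  shows "(\<Union>(a, c)\<in>X. \<Union>(a', c')\<in>Y. F a c a' c') = Z"
  using assms by fastforce

locale mult_closed =
  fixes S :: "'r::comm_ring_1 set"
  assumes one_mem: "1 \<in> S" and mult_mem: "g \<in> S \<Longrightarrow> g' \<in> S \<Longrightarrow> g * g' \<in> S"
begin

lemma equiv_frac_rel: "equiv (UNIV \<times> S) (frac_rel S)"
proof (rule equivI)
  show "frac_rel S \<subseteq> (UNIV \<times> S) \<times> (UNIV \<times> S)"
    by (auto simp: frac_rel_def)
  show "refl_on (UNIV \<times> S) (frac_rel S)"
    using one_mem by (auto simp: refl_on_def frac_rel_def)
  show "sym (frac_rel S)"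
  proof (rule symI)
    fix X Y assume "(X, Y) \<in> frac_rel S"
    then obtain f g f' g' u where *: "X = (f, g)" "Y = (f', g')" "g \<in> S" "g' \<in> S" "u \<in> S"
      "u * (f * g' - f' * g) = 0"
      by (auto simp: frac_rel_def)
    have "u * (f' * g - f * g') = - (u * (f * g' - f' * g))"
      by (simp add: algebra_simps)
    then show "(Y, X) \<in> frac_rel S"
      using * by (auto simp: frac_rel_def)
  qed
  show "trans (frac_rel S)"
  proof (rule transI)
    fix X Y Z assume "(X, Y) \<in> frac_rel S" "(Y, Z) \<in> frac_rel S"
    then obtain f g f' g' f'' g'' u v where *: "X = (f, g)" "Y = (f', g')" "Z = (f'', g'')"
      "g \<in> S" "g' \<in> S" "g'' \<in> S" "u \<in> S" "v \<in> S"
      "u * (f * g' - f' * g) = 0" "v * (f' * g'' - f'' * g') = 0"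
      by (auto simp: frac_rel_def)
    \<comment> \<open>The middle denominator \<open>g'\<close> joins the two witnesses: it lets the
      fraction \<open>f' / g'\<close> be eliminated between the two relations.\<close>
    have "(u * v * g') * (f * g'' - f'' * g) =
        v * g'' * (u * (f * g' - f' * g)) + u * g * (v * (f' * g'' - f'' * g'))"
      by (simp add: algebra_simps)
    then show "(X, Z) \<in> frac_rel S"
      using * mult_mem unfolding frac_rel_def by auto
  qed
qed

lemma loc_frac_eq_iff:
  assumes "g \<in> S" "g' \<in> S"
  shows "loc_frac S f g = loc_frac S f' g' \<longleftrightarrow> (\<exists>u\<in>S. u * (f * g' - f' * g) = 0)"
  using eq_equiv_class_iff[OF equiv_frac_rel, of "(f, g)" "(f', g')"] assms
  by (simp add: loc_frac_def frac_rel_def)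

lemma loc_frac_eqI:
  assumes "g \<in> S" "g' \<in> S" "f * g' = f' * g"
  shows "loc_frac S f g = loc_frac S f' g'"
  using assms one_mem by (auto simp: loc_frac_eq_iff intro!: bexI[of _ 1])

lemma mem_loc_frac_iff:
  "(f', g') \<in> loc_frac S f g \<longleftrightarrow> g \<in> S \<and> g' \<in> S \<and> loc_frac S f' g' = loc_frac S f g"
proof -
  have "(f', g') \<in> loc_frac S f g \<longleftrightarrow> ((f, g), (f', g')) \<in> frac_rel S"
    by (simp add: loc_frac_def)
  also have "\<dots> \<longleftrightarrow> g \<in> S \<and> g' \<in> S \<and> loc_frac S f g = loc_frac S f' g'"
    by (cases "g \<in> S \<and> g' \<in> S") (auto simp: loc_frac_eq_iff frac_rel_def)
  finally show ?thesis
    by auto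
qed

lemma carrier_localization: "carrier (localization S) = {loc_frac S f g | f g. g \<in> S}"
  by (auto simp: localization_def quotient_def loc_frac_def)

lemma loc_frac_closed [simp]: "g \<in> S \<Longrightarrow> loc_frac S f g \<in> carrier (localization S)"
  by (auto simp: carrier_localization)

lemma localization_cases:
  assumes "X \<in> carrier (localization S)"
  obtains f g where "X = loc_frac S f g" "g \<in> S"
  using assms by (auto simp: carrier_localization)

lemma mult_loc_frac [simp]:
  assumes "g \<in> S" "g' \<in> S"
  shows "loc_frac S f g \<otimes>\<^bsub>localization S\<^esub> loc_frac S f' g' = loc_frac S (f * f') (g * g')"
proof -
  have "loc_frac S (a * a') (c * c') = loc_frac S (f * f') (g * g')"
    if "(a, c) \<in> loc_frac S f g" "(a', c') \<in> loc_frac S f' g'" for a c a' c'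
  proof -
    from that have c: "c \<in> S" "c' \<in> S"
      by (simp_all add: mem_loc_frac_iff)
    with that assms obtain u v where uv: "u \<in> S" "v \<in> S"
      "u * (a * g - f * c) = 0" "v * (a' * g' - f' * c') = 0"
      by (auto simp: mem_loc_frac_iff loc_frac_eq_iff)
    \<comment> \<open>The cross difference is a combination of the two given ones, through the
      intermediate product \<open>f * c * a' * g'\<close>, so \<open>u * v\<close> annihilates
      it.\<close>
    have "(u * v) * ((a * a') * (g * g') - (f * f') * (c * c')) =
        v * a' * g' * (u * (a * g - f * c)) + u * f * c * (v * (a' * g' - f' * c'))"
      by (simp add: algebra_simps)
    then show ?thesis
      using uv c assms mult_mem by (auto simp: loc_frac_eq_iff)
  qed
  moreover have "(f, g) \<in> loc_frac S f g" "(f', g') \<in> loc_frac S f' g'"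
    using assms by (simp_all add: mem_loc_frac_iff)
  ultimately show ?thesis
    unfolding localization_def monoid.simps ring.simps by (intro UN_pair_eqI)
qed

lemma add_loc_frac [simp]:
  assumes "g \<in> S" "g' \<in> S"
  shows "loc_frac S f g \<oplus>\<^bsub>localization S\<^esub> loc_frac S f' g' = loc_frac S (f * g' + f' * g) (g * g')"
proof -
  have "loc_frac S (a * c' + a' * c) (c * c') = loc_frac S (f * g' + f' * g) (g * g')"
    if "(a, c) \<in> loc_frac S f g" "(a', c') \<in> loc_frac S f' g'" for a c a' c'
  proof -
    from that have c: "c \<in> S" "c' \<in> S"
      by (simp_all add: mem_loc_frac_iff)
    with that assms obtain u v where uv: "u \<in> S" "v \<in> S"
      "u * (a * g - f * c) = 0" "v * (a' * g' - f' * c') = 0"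
      by (auto simp: mem_loc_frac_iff loc_frac_eq_iff)
    \<comment> \<open>Again a combination of the two given relations, one for each summand of the
      sum of fractions.\<close>
    have "(u * v) * ((a * c' + a' * c) * (g * g') - (f * g' + f' * g) * (c * c')) =
        v * c' * g' * (u * (a * g - f * c)) + u * c * g * (v * (a' * g' - f' * c'))"
      by (simp add: algebra_simps)
    then show ?thesis
      using uv c assms mult_mem by (auto simp: loc_frac_eq_iff)
  qed
  moreover have "(f, g) \<in> loc_frac S f g" "(f', g') \<in> loc_frac S f' g'"
    using assms by (simp_all add: mem_loc_frac_iff)
  ultimately show ?thesis
    unfolding localization_def monoid.simps ring.simps by (intro UN_pair_eqI)
qed

lemma zero_localization: "\<zero>\<^bsub>localization S\<^esub> = loc_frac S 0 1"
  and one_localization: "\<one>\<^bsub>localization S\<^esub> = loc_frac S 1 1"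
  by (simp_all add: localization_def)

lemma cring_localization: "cring (localization S)"
proof (rule cringI)
  let ?R = "localization S"
  note [simp] = mult_mem one_mem zero_localization one_localization
  show "abelian_group ?R"
  proof (rule abelian_groupI)
    fix X Y Z assume "X \<in> carrier ?R" "Y \<in> carrier ?R" "Z \<in> carrier ?R"
    then obtain f g f' g' f'' g'' where [simp]: "X = loc_frac S f g" "Y = loc_frac S f' g'"
      "Z = loc_frac S f'' g''" "g \<in> S" "g' \<in> S" "g'' \<in> S"
      by (elim localization_cases) blast
    show "X \<oplus>\<^bsub>?R\<^esub> Y \<oplus>\<^bsub>?R\<^esub> Z = X \<oplus>\<^bsub>?R\<^esub> (Y \<oplus>\<^bsub>?R\<^esub> Z)"
      by simp (rule loc_frac_eqI; simp add: algebra_simps)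
  next
    fix X Y assume "X \<in> carrier ?R" "Y \<in> carrier ?R"
    then obtain f g f' g' where [simp]: "X = loc_frac S f g" "Y = loc_frac S f' g'" "g \<in> S" "g' \<in> S"
      by (elim localization_cases) blast
    show "X \<oplus>\<^bsub>?R\<^esub> Y \<in> carrier ?R"
      by simp
    show "X \<oplus>\<^bsub>?R\<^esub> Y = Y \<oplus>\<^bsub>?R\<^esub> X"
      by simp (rule loc_frac_eqI; simp add: algebra_simps)
  next
    fix X assume "X \<in> carrier ?R"
    then obtain f g where [simp]: "X = loc_frac S f g" "g \<in> S"
      by (elim localization_cases) blast
    show "\<zero>\<^bsub>?R\<^esub> \<oplus>\<^bsub>?R\<^esub> X = X"
      by simp
    have "loc_frac S (- f) g \<oplus>\<^bsub>?R\<^esub> X = \<zero>\<^bsub>?R\<^esub>"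
      by simp (rule loc_frac_eqI; simp)
    then show "\<exists>Y\<in>carrier ?R. Y \<oplus>\<^bsub>?R\<^esub> X = \<zero>\<^bsub>?R\<^esub>"
      by (rule bexI) simp
  qed simp
  show "comm_monoid ?R"
  proof (rule comm_monoidI)
    fix X Y Z assume "X \<in> carrier ?R" "Y \<in> carrier ?R" "Z \<in> carrier ?R"
    then obtain f g f' g' f'' g'' where [simp]: "X = loc_frac S f g" "Y = loc_frac S f' g'"
      "Z = loc_frac S f'' g''" "g \<in> S" "g' \<in> S" "g'' \<in> S"
      by (elim localization_cases) blast
    show "X \<otimes>\<^bsub>?R\<^esub> Y \<otimes>\<^bsub>?R\<^esub> Z = X \<otimes>\<^bsub>?R\<^esub> (Y \<otimes>\<^bsub>?R\<^esub> Z)"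
      by (simp add: mult.assoc)
  next
    fix X Y assume "X \<in> carrier ?R" "Y \<in> carrier ?R"
    then obtain f g f' g' where [simp]: "X = loc_frac S f g" "Y = loc_frac S f' g'" "g \<in> S" "g' \<in> S"
      by (elim localization_cases) blast
    show "X \<otimes>\<^bsub>?R\<^esub> Y \<in> carrier ?R"
      by simp
    show "X \<otimes>\<^bsub>?R\<^esub> Y = Y \<otimes>\<^bsub>?R\<^esub> X"
      by (simp add: mult.commute)
  next
    fix X assume "X \<in> carrier ?R"
    then show "\<one>\<^bsub>?R\<^esub> \<otimes>\<^bsub>?R\<^esub> X = X"
      by (elim localization_cases) simp
  qed simp
  fix X Y Z assume "X \<in> carrier ?R" "Y \<in> carrier ?R" "Z \<in> carrier ?R"
  then obtain f g f' g' f'' g'' where [simp]: "X = loc_frac S f g" "Y = loc_frac S f' g'"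
    "Z = loc_frac S f'' g''" "g \<in> S" "g' \<in> S" "g'' \<in> S"
    by (elim localization_cases) blast
  \<comment> \<open>After both sides are computed, the right one has an extra factor
    \<open>g''\<close> in numerator and denominator.\<close>
  show "(X \<oplus>\<^bsub>?R\<^esub> Y) \<otimes>\<^bsub>?R\<^esub> Z = X \<otimes>\<^bsub>?R\<^esub> Z \<oplus>\<^bsub>?R\<^esub> Y \<otimes>\<^bsub>?R\<^esub> Z"
    by simp (rule loc_frac_eqI; simp add: algebra_simps)
qed

end


section \<open>Multiplicity one\<close>

text \<open>The inductive definition is unfolded twice: one line extension over the zero
  space.\<close>

lemma (in ring) dimension_one_obtain_generator:
  assumes "dimension 1 K E" "K \<subseteq> carrier R"
  obtains v where "v \<in> carrier R" "\<And>x. x \<in> E \<Longrightarrow> \<exists>k\<in>K. x = k \<otimes> v"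
proof -
  obtain v E' where v: "v \<in> carrier R" "E = line_extension K v E'" and E': "dimension 0 K E'"
    using assms(1) by (cases rule: dimension.cases) auto
  from E' have "E' = {\<zero>}"
    by (cases rule: dimension.cases)
  have "\<exists>k\<in>K. x = k \<otimes> v" if "x \<in> E" for x
  proof -
    obtain k where "k \<in> K" "x = k \<otimes> v \<oplus> \<zero>"
      using \<open>x \<in> E\<close> unfolding v(2) \<open>E' = {\<zero>}\<close> line_extension_mem_iff by blast
    then show ?thesis
      using v(1) assms(2) by (intro bexI[of _ k]) auto
  qed
  with v(1) show ?thesis
    using that by blast
qed

lemma mult_closed_nonvanishing: "mult_closed (nonvanishing p)"
  by unfold_locales (simp_all add: nonvanishing_def)

lemma cring_local_ring: "cring (local_ring p)"
  unfolding local_ring_def by (rule mult_closed.cring_localization[OF mult_closed_nonvanishing])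

lemma system_ideal_is_ideal: "ideal (system_ideal F p) (local_ring p)"
proof -
  interpret mult_closed "nonvanishing p"
    by (rule mult_closed_nonvanishing)
  interpret cring "local_ring p"
    by (rule cring_local_ring)
  show ?thesis
    unfolding system_ideal_def
    by (rule genideal_ideal) (auto simp: local_ring_def one_mem)
qed

text \<open>Pulls a generator of the quotient back to the local ring, so that later computations use
  fractions instead of cosets.\<close>

lemma has_multiplicity_one_obtain_generator:
  assumes "has_multiplicity F p 1"
  obtains V where "V \<in> carrier (local_ring p)"
    "\<And>X. X \<in> carrier (local_ring p) \<Longrightarrow> \<exists>c. \<exists>j\<in>system_ideal F p.
       X = j \<oplus>\<^bsub>local_ring p\<^esub> loc_frac (nonvanishing p) (cpoly_const c) 1 \<otimes>\<^bsub>local_ring p\<^esub> V"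
proof -
  interpret mult_closed "nonvanishing p"
    by (rule mult_closed_nonvanishing)
  interpret R: cring "local_ring p"
    by (rule cring_local_ring)
  interpret I: ideal "system_ideal F p" "local_ring p"
    by (rule system_ideal_is_ideal)
  let ?Q = "multiplicity_ring F p"
  let ?q = "a_r_coset (local_ring p) (system_ideal F p)"
  let ?c = "\<lambda>c. loc_frac (nonvanishing p) (cpoly_const c) 1"
  interpret q: ring_hom_ring "local_ring p" ?Q ?q
    unfolding multiplicity_ring_def by (rule I.rcos_ring_hom_ring)
  have c [simp]: "?c c \<in> carrier (local_ring p)" for c
    by (simp add: local_ring_def one_mem)
  have "multiplicity_scalars F p \<subseteq> carrier ?Q"
    by (auto simp: multiplicity_scalars_def)
  then obtain v where v: "v \<in> carrier ?Q"
    "\<And>x. x \<in> carrier ?Q \<Longrightarrow> \<exists>k\<in>multiplicity_scalars F p. x = k \<otimes>\<^bsub>?Q\<^esub> v"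
    using q.S.dimension_one_obtain_generator assms unfolding has_multiplicity_def by blast
  from v(1) obtain V where V: "V \<in> carrier (local_ring p)" "v = ?q V"
    unfolding multiplicity_ring_def FactRing_def A_RCOSETS_def' partial_object.simps by blast
  show ?thesis
  proof (rule that[OF V(1)])
    fix X assume X: "X \<in> carrier (local_ring p)"
    obtain c where "?q X = ?q (?c c) \<otimes>\<^bsub>?Q\<^esub> v"
      using v(2)[of "?q X"] X by (auto simp: multiplicity_scalars_def)
    then have "?q X = ?q (?c c \<otimes>\<^bsub>local_ring p\<^esub> V)"
      using V by simp
    \<comment> \<open>An element lies in its own coset, so equality of cosets becomes membership,
      which supplies the ideal element \<open>j\<close>.\<close>
    then have "X \<in> ?q (?c c \<otimes>\<^bsub>local_ring p\<^esub> V)"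
      using I.a_rcos_self[OF X] by simp
    then show "\<exists>c. \<exists>j\<in>system_ideal F p. X = j \<oplus>\<^bsub>local_ring p\<^esub> ?c c \<otimes>\<^bsub>local_ring p\<^esub> V"
      by (auto simp: a_r_coset_def')
  qed
qed

section \<open>Fractions vanishing to first order along a direction\<close>

text \<open>The kernel of the homomorphism from the local ring to the dual numbers given by \<open>u\<close>.\<close>

definition null_fractions ::
    "complex ^ 'n::finite \<Rightarrow> complex ^ 'n \<Rightarrow> ('n cpoly \<times> 'n cpoly) set set" where
  "null_fractions p u = {loc_frac (nonvanishing p) f g | f g.
     g \<in> nonvanishing p \<and> cpoly_eval f p = 0 \<and> dir_deriv p u f = 0}"

lemma null_fractionsI:
  "g \<in> nonvanishing p \<Longrightarrow> cpoly_eval f p = 0 \<Longrightarrow> dir_deriv p u f = 0 \<Longrightarrow>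
    loc_frac (nonvanishing p) f g \<in> null_fractions p u"
  by (auto simp: null_fractions_def)

text \<open>By the product rule, a numerator whose value and derivative vanish keeps this property
  under multiplication by any polynomial. This covers both common denominators and products with
  arbitrary fractions.\<close>

lemma null_fractions_is_ideal: "ideal (null_fractions p u) (local_ring p)"
proof -
  interpret mult_closed "nonvanishing p"
    by (rule mult_closed_nonvanishing)
  interpret R: cring "local_ring p"
    by (rule cring_local_ring)
  let ?J = "null_fractions p u"
  let ?frac = "loc_frac (nonvanishing p)"
  have carrier: "?J \<subseteq> carrier (local_ring p)"
    by (auto simp: null_fractions_def local_ring_def)
  show ?thesis
  proof (rule idealI)
    show "ring (local_ring p)"
      by (rule R.ring_axioms)
    show "subgroup ?J (add_monoid (local_ring p))"
    proof (rule R.add.subgroupI)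
      show "?J \<subseteq> carrier (local_ring p)"
        by (rule carrier)
      have "?frac 0 1 \<in> ?J"
        by (rule null_fractionsI) (simp_all add: one_mem)
      then show "?J \<noteq> {}"
        by blast
    next
      fix X assume "X \<in> ?J"
      then obtain f g where X: "X = ?frac f g" "g \<in> nonvanishing p" "cpoly_eval f p = 0" "dir_deriv p u f = 0"
        by (auto simp: null_fractions_def)
      have "?frac (0 - f) g \<oplus>\<^bsub>local_ring p\<^esub> X = \<zero>\<^bsub>local_ring p\<^esub>"
        using X unfolding local_ring_def zero_localization
        by simp (rule loc_frac_eqI; simp add: mult_mem one_mem)
      then have "\<ominus>\<^bsub>local_ring p\<^esub> X = ?frac (0 - f) g"
        using X by (intro R.minus_equality) (simp_all add: local_ring_def)
      moreover have "?frac (0 - f) g \<in> ?J"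
        by (rule null_fractionsI) (simp_all only: X cpoly_eval_diff dir_deriv_diff cpoly_eval_0 dir_deriv_0 diff_self)
      ultimately show "\<ominus>\<^bsub>local_ring p\<^esub> X \<in> ?J"
        by simp
    next
      fix X Y assume "X \<in> ?J" "Y \<in> ?J"
      then obtain f g f' g' where "X = ?frac f g" "Y = ?frac f' g'"
        "g \<in> nonvanishing p" "g' \<in> nonvanishing p"
        "cpoly_eval f p = 0" "dir_deriv p u f = 0" "cpoly_eval f' p = 0" "dir_deriv p u f' = 0"
        unfolding null_fractions_def by blast
      then show "X \<oplus>\<^bsub>local_ring p\<^esub> Y \<in> ?J"
        by (simp add: local_ring_def null_fractionsI mult_mem)
    qed
    fix X Y assume "X \<in> ?J" "Y \<in> carrier (local_ring p)"
    then obtain f g f' g' where XY: "X = ?frac f g" "Y = ?frac f' g'"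
      "g \<in> nonvanishing p" "g' \<in> nonvanishing p" "cpoly_eval f p = 0" "dir_deriv p u f = 0"
      by (auto simp: null_fractions_def local_ring_def carrier_localization)
    then show "Y \<otimes>\<^bsub>local_ring p\<^esub> X \<in> ?J"
      by (simp add: local_ring_def null_fractionsI mult_mem)
    with \<open>X \<in> ?J\<close> \<open>Y \<in> carrier (local_ring p)\<close> carrier show "X \<otimes>\<^bsub>local_ring p\<^esub> Y \<in> ?J"
      by (simp add: R.m_comm subset_iff)
  qed
qed

text \<open>The homomorphism to the dual numbers enters through its kernel, an ideal containing the
  system ideal. The first-order parts of all fractions are then scalar multiples of that of
  \<open>V\<close>.\<close>

lemma multiplicity_one_no_tangent:
  assumes mult: "has_multiplicity F p 1"
    and eval: "\<And>k. cpoly_eval (F k) p = 0" and tangent: "\<And>k. dir_deriv p u (F k) = 0"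
  shows "u = 0"
proof -
  interpret mult_closed "nonvanishing p"
    by (rule mult_closed_nonvanishing)
  let ?frac = "loc_frac (nonvanishing p)"
  \<comment> \<open>A generated ideal is the least ideal containing its generators, and each
    equation vanishes to first order along \<open>u\<close>.\<close>
  have "system_ideal F p \<subseteq> null_fractions p u"
    unfolding system_ideal_def genideal_def
    using null_fractions_is_ideal eval tangent one_mem
    by (intro Inter_lower) (auto intro!: null_fractionsI)
  then have null: "j \<in> null_fractions p u" if "j \<in> system_ideal F p" for j
    using that by blast
  obtain V where "V \<in> carrier (local_ring p)" and generator:
    "\<And>X. X \<in> carrier (local_ring p) \<Longrightarrow> \<exists>c. \<exists>j\<in>system_ideal F p.
       X = j \<oplus>\<^bsub>local_ring p\<^esub> ?frac (cpoly_const c) 1 \<otimes>\<^bsub>local_ring p\<^esub> V"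
    using has_multiplicity_one_obtain_generator[OF mult] by blast
  from this(1) obtain r s where V: "V = ?frac r s" "s \<in> nonvanishing p"
    by (auto simp: local_ring_def carrier_localization)
  \<comment> \<open>This is \<open>f / 1 = j / g + c * r / s\<close> over a common denominator,
    where \<open>j / g\<close> is negligible to first order.\<close>
  have *: "\<exists>c j g. g \<in> nonvanishing p \<and> cpoly_eval j p = 0 \<and> dir_deriv p u j = 0 \<and>
      ?frac f 1 = ?frac (j * s + (cpoly_const c * r) * g) (g * s)" for f
  proof -
    have "?frac f 1 \<in> carrier (local_ring p)"
      by (simp add: local_ring_def one_mem)
    then obtain c j where "j \<in> system_ideal F p" and
      eq: "?frac f 1 = j \<oplus>\<^bsub>local_ring p\<^esub> ?frac (cpoly_const c) 1 \<otimes>\<^bsub>local_ring p\<^esub> V"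
      using generator by blast
    from null[OF this(1)] obtain j' g where j: "j = ?frac j' g" "g \<in> nonvanishing p"
      "cpoly_eval j' p = 0" "dir_deriv p u j' = 0"
      unfolding null_fractions_def by blast
    have "?frac f 1 = ?frac (j' * s + (cpoly_const c * r) * g) (g * s)"
      using eq j(1,2) V by (simp add: local_ring_def one_mem)
    with j show ?thesis
      by blast
  qed
  \<comment> \<open>In the dual numbers this reads \<open>f * s = c * r\<close>, split into value
    and derivative with the same scalar \<open>c\<close>. It follows by cancelling the nonzero
    values of \<open>w\<close> and \<open>g\<close>.\<close>
  have scalar: "\<exists>c. cpoly_eval f p * cpoly_eval s p = c * cpoly_eval r p \<and>
      dir_deriv p u f * cpoly_eval s p + cpoly_eval f p * dir_deriv p u s = c * dir_deriv p u r" for f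
  proof -
    obtain c j g where g: "g \<in> nonvanishing p" and j: "cpoly_eval j p = 0" "dir_deriv p u j = 0"
      and "?frac f 1 = ?frac (j * s + (cpoly_const c * r) * g) (g * s)"
      using * by blast
    then obtain w where w: "w \<in> nonvanishing p"
      and eq: "w * (f * (g * s) - (j * s + (cpoly_const c * r) * g) * 1) = 0"
      using V(2) by (subst (asm) loc_frac_eq_iff) (auto simp: one_mem mult_mem)
    have wg: "cpoly_eval w p \<noteq> 0" "cpoly_eval g p \<noteq> 0"
      using w g by (simp_all add: nonvanishing_def)
    have 1: "cpoly_eval w p * (cpoly_eval g p * (cpoly_eval f p * cpoly_eval s p - c * cpoly_eval r p)) = 0"
      using arg_cong[OF eq, of "\<lambda>f. cpoly_eval f p"] j by (simp add: algebra_simps)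
    then have ev: "cpoly_eval f p * cpoly_eval s p = c * cpoly_eval r p"
      using wg by simp
    \<comment> \<open>The product rule for \<open>w * g * (f * s - c * r)\<close>: the terms with \<open>j\<close> drop out.\<close>
    have "dir_deriv p u w * cpoly_eval g p * (cpoly_eval f p * cpoly_eval s p - c * cpoly_eval r p)
      + cpoly_eval w p * dir_deriv p u g * (cpoly_eval f p * cpoly_eval s p - c * cpoly_eval r p)
      + cpoly_eval w p * cpoly_eval g p *
        (dir_deriv p u f * cpoly_eval s p + cpoly_eval f p * dir_deriv p u s - c * dir_deriv p u r) = 0"
      using arg_cong[OF eq, of "dir_deriv p u"] j by (simp add: algebra_simps)
    then show ?thesis
      using wg ev by (intro exI[of _ c]) simp
  qed
  have s: "cpoly_eval s p \<noteq> 0"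
    using V(2) by (simp add: nonvanishing_def)
  \<comment> \<open>The polynomial 1 has a nonzero value, so the generator cannot vanish at
    \<open>p\<close>.\<close>
  obtain c where "cpoly_eval s p = c * cpoly_eval r p"
    using scalar[of 1] by auto
  with s have r: "cpoly_eval r p \<noteq> 0"
    by auto
  \<comment> \<open>The value of the \<open>i\<close>-th coordinate minus \<open>p $ i\<close> is 0,
    which forces its scalar to be 0; the derivative equation then reads
    \<open>u $ i * cpoly_eval s p = 0\<close>.\<close>
  have "u $ i = 0" for i
    using scalar[of "cpoly_var i - cpoly_const (p $ i)"] r s by auto
  then show ?thesis
    by (simp add: vec_eq_iff)
qed

theorem theorem1:
  fixes h :: "'k::finite \<Rightarrow> ('n::finite + 'm::finite) cpoly"
    and x :: "complex ^ 'm \<Rightarrow> complex ^ 'n"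
    and b :: "complex ^ 'm"
  assumes isolated: "x b isolated_in solutions (\<lambda>k. specialize b (h k))"
    and multiplicity_one: "has_multiplicity (\<lambda>k. specialize b (h k)) (x b) 1"
    and solution: "\<forall>\<^sub>F a in nhds b. \<forall>k. cpoly_eval2 (h k) (x a) a = 0"
    and continuous: "isCont x b"
  shows "partially_differentiable x b \<and>
    jacobian_matrix x b =
      - (pinv (jacobian_matrix (\<lambda>y. \<chi> k. cpoly_eval2 (h k) y b) (x b)) **
         jacobian_matrix (\<lambda>a. \<chi> k. cpoly_eval2 (h k) (x b) a) b)"
proof -
  let ?H = "\<lambda>(y, a). \<chi> k. cpoly_eval2 (h k) y a"
  obtain A B where H: "(?H has_derivative (\<lambda>(d, e). A *v d + B *v e)) (at (x b, b))"
    by (rule cpoly_eval2_system_has_derivative)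
  \<comment> \<open>Freezing one group of unknowns composes \<open>?H\<close> with an affine
    embedding, so \<open>A\<close> and \<open>B\<close> are the two Jacobian matrices of the
    claim.\<close>
  have "((\<lambda>y. ?H (y, b)) has_derivative (\<lambda>d. case (d, 0) of (d, e) \<Rightarrow> A *v d + B *v e)) (at (x b))"
    by (rule has_derivative_compose[where f = "\<lambda>y. (y, b)" and g = ?H])
      (use H in \<open>auto intro!: derivative_eq_intros\<close>)
  then have HA: "((\<lambda>y. \<chi> k. cpoly_eval2 (h k) y b) has_derivative (*v) A) (at (x b))"
    by simp
  have "((\<lambda>a. ?H (x b, a)) has_derivative (\<lambda>e. case (0, e) of (d, e) \<Rightarrow> A *v d + B *v e)) (at b)"
    by (rule has_derivative_compose[where f = "\<lambda>a. (x b, a)" and g = ?H])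
      (use H in \<open>auto intro!: derivative_eq_intros\<close>)
  then have HB: "((\<lambda>a. \<chi> k. cpoly_eval2 (h k) (x b) a) has_derivative (*v) B) (at b)"
    by simp
  have "u = 0" if "A *v u = 0" for u
  proof (rule multiplicity_one_no_tangent[OF multiplicity_one])
    show "cpoly_eval (specialize b (h k)) (x b) = 0" for k
      using eventually_nhds_x_imp_x[OF solution] by (simp add: cpoly_eval_specialize)
    show "dir_deriv (x b) u (specialize b (h k)) = 0" for k
      using dir_deriv_eq_matrix_mult[of "\<lambda>k. specialize b (h k)" A "x b" u k] HA that
      by (simp add: cpoly_eval_specialize)
  qed
  then have "pinv A ** A = mat 1"
    by (rule pinv_mult_injective)
  moreover have "\<forall>\<^sub>F a in nhds b. ?H (x a, a) = 0"
    using solution by (simp add: vec_eq_iff)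
  \<comment> \<open>The left inverse \<open>L\<close> is multiplication by
    \<open>pinv A\<close>.\<close>
  ultimately have "(x has_derivative (\<lambda>e. - (pinv A *v (B *v e)))) (at b)"
    by (intro implicit_function_has_derivative[where f = ?H and A = "(*v) A"] H continuous
        matrix_vector_mul_bounded_linear) (simp_all add: matrix_vector_mul_assoc)
  also have "(\<lambda>e. - (pinv A *v (B *v e))) = (*v) (- (pinv A ** B))"
  proof
    fix e
    have "(- M) *v e = - (M *v e)" for M :: "complex ^ 'm ^ 'n"
      by (simp add: matrix_vector_mult_def vec_eq_iff sum_negf)
    then show "- (pinv A *v (B *v e)) = (- (pinv A ** B)) *v e"
      by (simp add: matrix_vector_mul_assoc)
  qed
  finally show ?thesis
    using has_derivative_matrix_imp_jacobian HA HB by metis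
qed

end
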